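(* Let $(\mathbb{X},\|\cdot\|_{\mathbb{X}})$ be a real normed space and let $f:\mathbb{X}\to\mathbb{R}$ be a proper function. Assume that $f$ has a finite subderivative at $\overline{x}\in\mathbb{X}$ in every direction $x-\overline{x}$ with arbitrary $x\in\mathbb{X}$. Then $f$ is radially epidifferentiable at $\overline{x}$ and $$f^r(\overline{x};x-\overline{x})=\mathrm{d}f(\overline{x};x-\overline{x})\quad\text{for all } x\in\mathbb{X}$$ if and only if $$f(x)-f(\overline{x})\ge \mathrm{d}f(\overline{x};x-\overline{x})\quad\text{for all } x\in\mathbb{X}.$$
   Context: For $h\in\mathbb{X}$, the (Rockafellar) subderivative is $\mathrm{d}f(\overline{x};h)=\liminf_{t\downarrow 0,\ u\to h}\frac{f(\overline{x}+tu)-f(\overline{x})}{t}$. For a nonempty subset $A$ of a real normed space and $a\in A$, the closed radial cone is $R(A;a)=\mathrm{cl}(\mathrm{cone}(A-a))$, i.e. the set of all $w$ for which there are $\lambda_n>0$ and $a_n\in A$ with $\lim_{n\to\infty}\lambda_n(a_n-a)=w$. The epigraph of $f$ is $\mathrm{epi}\,f=\{(x,y)\in\mathbb{X}\times\mathbb{R}: f(x)\le y\}$. The radial epiderivative $f^r(\overline{x};\cdot)$ is the function defined by $\mathrm{epi}\,f^r(\overline{x};\cdot)=R(\mathrm{epi}\,f;(\overline{x},f(\overline{x})))$; thus $f^r(\overline{x};h)=\inf\{y\in\mathbb{R}:(h,y)\in R(\mathrm{epi}\,f;(\overline{x},f(\overline{x})))\}$. The function $f$ is called radially epidifferentiable at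 $\overline{x}$ if $f^r(\overline{x};h)$ exists and is finite for every $h\in\mathbb{X}$. *)

theory Defs
  imports "HOL-Analysis.Analysis"
begin

definition proper_function :: "('a \<Rightarrow> ereal) \<Rightarrow> bool" where
  "proper_function g \<longleftrightarrow> (\<exists>x. g x < \<infinity>) \<and> (\<forall>x. - \<infinity> < g x)"

definition subderivative :: "('a::real_normed_vector \<Rightarrow> real) \<Rightarrow> 'a \<Rightarrow> 'a \<Rightarrow> ereal" where
  "subderivative f xbar h =
     Liminf (at_right 0 \<times>\<^sub>F nhds h) (\<lambda>(t, u). ereal ((f (xbar + t *\<^sub>R u) - f xbar) / t))"

definition radial_cone :: "'a::real_normed_vector set \<Rightarrow> 'a \<Rightarrow> 'a set" where
  "radial_cone A a = closure (cone hull ((\<lambda>x. x - a) ` A))"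

lemma mem_radial_cone_iff:
  assumes "a \<in> A"
  shows "w \<in> radial_cone A a \<longleftrightarrow>
    (\<exists>(l :: nat \<Rightarrow> real) s. (\<forall>n. 0 < l n \<and> s n \<in> A) \<and> (\<lambda>n. l n *\<^sub>R (s n - a)) \<longlonglongrightarrow> w)"
proof
  assume "w \<in> radial_cone A a"
  then obtain v where v: "\<And>n. v n \<in> cone hull ((\<lambda>x. x - a) ` A)" "v \<longlonglongrightarrow> w"
    unfolding radial_cone_def closure_sequential by blast
  have "\<exists>l s. 0 < l \<and> s \<in> A \<and> v n = l *\<^sub>R (s - a)" for n
  proof -
    from v(1)[of n] obtain c x where c: "0 \<le> c" "x \<in> A" "v n = c *\<^sub>R (x - a)"
      unfolding cone_hull_expl by auto
    show ?thesis
    proof (cases "c = 0")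
      case True
      then have "0 < (1::real) \<and> a \<in> A \<and> v n = 1 *\<^sub>R (a - a)"
        using c assms by simp
      then show ?thesis by blast
    next
      case False
      with c have "0 < c" by simp
      with c show ?thesis by blast
    qed
  qed
  then obtain l s where "\<And>n. 0 < l n \<and> s n \<in> A \<and> v n = l n *\<^sub>R (s n - a)"
    by metis
  moreover from this have "v = (\<lambda>n. l n *\<^sub>R (s n - a))"
    by (intro ext) simp
  ultimately have "(\<forall>n. 0 < l n \<and> s n \<in> A) \<and> (\<lambda>n. l n *\<^sub>R (s n - a)) \<longlonglongrightarrow> w"
    using v(2) by simp
  then show "\<exists>(l :: nat \<Rightarrow> real) s. (\<forall>n. 0 < l n \<and> s n \<in> A) \<and> (\<lambda>n. l n *\<^sub>R (s n - a)) \<longlonglongrightarrow> w"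
    by blast
next
  assume "\<exists>(l :: nat \<Rightarrow> real) s. (\<forall>n. 0 < l n \<and> s n \<in> A) \<and> (\<lambda>n. l n *\<^sub>R (s n - a)) \<longlonglongrightarrow> w"
  then obtain l s where ls: "\<And>n. 0 < (l n :: real)" "\<And>n. s n \<in> A" "(\<lambda>n. l n *\<^sub>R (s n - a)) \<longlonglongrightarrow> w"
    by blast
  have "l n *\<^sub>R (s n - a) \<in> cone hull ((\<lambda>x. x - a) ` A)" for n
    using ls(1,2)[of n] unfolding cone_hull_expl by (auto intro: less_imp_le)
  then show "w \<in> radial_cone A a"
    unfolding radial_cone_def closure_sequential
    using ls(3) by (intro exI[of _ "\<lambda>n. l n *\<^sub>R (s n - a)"]) simp
qed

definition radial_epiderivative :: "('a::real_normed_vector \<Rightarrow> real) \<Rightarrow> 'a \<Rightarrow> 'a \<Rightarrow> ereal" where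
  "radial_epiderivative f xbar h =
     Inf (ereal ` {y. (h, y) \<in> radial_cone (epigraph UNIV f) (xbar, f xbar)})"

lemma radial_cone_epigraph_upward:
  assumes "(h, y) \<in> radial_cone (epigraph UNIV f) (xbar, f xbar)" "y \<le> z"
  shows "(h, z) \<in> radial_cone (epigraph UNIV f) (xbar, f xbar)"
proof -
  have base: "(xbar, f xbar) \<in> epigraph UNIV f" by (simp add: epigraph_def)
  obtain l s where ls: "\<And>n. 0 < (l n :: real)" "\<And>n. s n \<in> epigraph UNIV f"
    "(\<lambda>n. l n *\<^sub>R (s n - (xbar, f xbar))) \<longlonglongrightarrow> (h, y)"
    using assms(1) unfolding mem_radial_cone_iff[OF base] by blast
  define r where "r = (\<lambda>n. s n + (0, (z - y) / l n))"
  have "r n \<in> epigraph UNIV f" for n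
    using ls(1,2)[of n] assms(2) by (auto simp: r_def epigraph_def intro!: add_increasing2)
  moreover have "l n *\<^sub>R (r n - (xbar, f xbar)) = l n *\<^sub>R (s n - (xbar, f xbar)) + (0, z - y)" for n
    using ls(1)[of n] by (cases "s n") (simp add: r_def field_simps)
  moreover have "(\<lambda>n. l n *\<^sub>R (s n - (xbar, f xbar)) + (0, z - y)) \<longlonglongrightarrow> (h, y) + (0, z - y)"
    by (intro tendsto_intros ls(3))
  ultimately have "\<forall>n. 0 < l n \<and> r n \<in> epigraph UNIV f"
    "(\<lambda>n. l n *\<^sub>R (r n - (xbar, f xbar))) \<longlonglongrightarrow> (h, z)"
    using ls(1) by simp_all
  then show ?thesis unfolding mem_radial_cone_iff[OF base] by blast
qed

text \<open>The infimum is the unique extended-real function whose epigraph is the radial cone; in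
  particular such a function always exists.\<close>

lemma epigraph_radial_epiderivative:
  "{(h, y). radial_epiderivative f xbar h \<le> ereal y} = radial_cone (epigraph UNIV f) (xbar, f xbar)"
proof -
  let ?R = "radial_cone (epigraph UNIV f) (xbar, f xbar)"
  have "(h, y) \<in> ?R" if le: "radial_epiderivative f xbar h \<le> ereal y" for h y
  proof -
    have "(h, y + 1 / real (Suc n)) \<in> ?R" for n
    proof -
      have "radial_epiderivative f xbar h < ereal (y + 1 / real (Suc n))"
        by (rule le_less_trans[OF le]) simp
      then obtain z where "(h, z) \<in> ?R" "z < y + 1 / real (Suc n)"
        unfolding radial_epiderivative_def Inf_less_iff by auto
      then show ?thesis by (meson less_imp_le radial_cone_epigraph_upward)
    qed
    moreover have "(\<lambda>n. (h, y + 1 / real (Suc n))) \<longlonglongrightarrow> (h, y + 0)"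
      by (intro tendsto_intros LIMSEQ_Suc[OF lim_1_over_n])
    moreover have "closed ?R" by (simp add: radial_cone_def)
    ultimately show ?thesis
      using closed_sequentially[of ?R "\<lambda>n. (h, y + 1 / real (Suc n))" "(h, y)"] by simp
  qed
  moreover have "radial_epiderivative f xbar h \<le> ereal y" if "(h, y) \<in> ?R" for h y
    unfolding radial_epiderivative_def using that by (auto intro: Inf_lower)
  ultimately show ?thesis by auto
qed

lemma radial_epiderivative_unique:
  assumes "{(h, y). g h \<le> ereal y} = radial_cone (epigraph UNIV f) (xbar, f xbar)"
  shows "g = radial_epiderivative f xbar"
proof
  fix h
  have *: "g h \<le> ereal y \<longleftrightarrow> radial_epiderivative f xbar h \<le> ereal y" for y
    using assms epigraph_radial_epiderivative[of f xbar] by (auto simp: set_eq_iff)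
  show "g h = radial_epiderivative f xbar h"
  proof (rule antisym)
    show "g h \<le> radial_epiderivative f xbar h"
      by (rule ereal_le_real) (simp add: *)
    show "radial_epiderivative f xbar h \<le> g h"
      by (rule ereal_le_real) (simp add: *)
  qed
qed

definition radially_epidifferentiable :: "('a::real_normed_vector \<Rightarrow> real) \<Rightarrow> 'a \<Rightarrow> bool" where
  "radially_epidifferentiable f xbar \<longleftrightarrow> (\<forall>h. \<bar>radial_epiderivative f xbar h\<bar> \<noteq> \<infinity>)"

end

theory Submission
  imports Defs
begin

text \<open>The subderivative is lower semicontinuous and positively homogeneous in the direction, so
  its epigraph is a closed cone. If the increments of \<open>f\<close> dominate the subderivative, this cone
  contains the translated epigraph of \<open>f\<close>, hence also its closed radial cone, and the radial
  epiderivative dominates the subderivative. The reverse bound, and the bound of the radial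
  epiderivative by the increments of \<open>f\<close>, hold unconditionally.\<close>

text \<open>A strict lower bound on the difference quotients holds on a whole product of a right
  neighbourhood of 0 and a neighbourhood of \<open>h\<close>. The latter is also a neighbourhood of
  every \<open>v\<close> close to \<open>h\<close>, so the same bound serves there; strictness is
  lost in the liminf.\<close>

lemma eventually_subderivative_ge:
  assumes "c < subderivative f xbar h"
  shows "\<forall>\<^sub>F v in nhds h. c \<le> subderivative f xbar v"
proof -
  have "\<forall>\<^sub>F p in at_right 0 \<times>\<^sub>F nhds h.
      c < (case p of (t, u) \<Rightarrow> ereal ((f (xbar + t *\<^sub>R u) - f xbar) / t))"
    using assms less_LiminfD unfolding subderivative_def by blast
  then obtain P Q where P: "eventually P (at_right 0)" and Q: "eventually Q (nhds h)"
    and PQ: "\<And>t u. P t \<Longrightarrow> Q u \<Longrightarrow> c < ereal ((f (xbar + t *\<^sub>R u) - f xbar) / t)"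
    unfolding eventually_prod_filter by auto
  have "c \<le> subderivative f xbar v" if "eventually Q (nhds v)" for v
    unfolding subderivative_def
    by (rule Liminf_bounded, unfold eventually_prod_filter, rule exI[of _ P], rule exI[of _ Q])
       (use P that PQ in \<open>auto intro: less_imp_le\<close>)
  moreover have "\<forall>\<^sub>F v in nhds h. eventually Q (nhds v)"
    using Q by (simp add: eventually_eventually)
  ultimately show ?thesis by (auto elim: eventually_mono)
qed

lemma closed_subderivative_epigraph: "closed {(h, y). subderivative f xbar h \<le> ereal y}"
proof -
  have "subderivative f xbar h \<le> ereal y"
    if s: "\<And>n. subderivative f xbar (fst (s n)) \<le> ereal (snd (s n))" and lim: "s \<longlonglongrightarrow> (h, y)"
    for s h y
  \<comment> \<open>Only the bound \<open>c\<close> is carried to the limit: the subderivatives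
    along the sequence need not converge.\<close>
  proof (rule dense_le)
    fix c assume "c < subderivative f xbar h"
    moreover have "(\<lambda>n. fst (s n)) \<longlonglongrightarrow> h" using tendsto_fst[OF lim] by simp
    ultimately have "\<forall>\<^sub>F n in sequentially. c \<le> subderivative f xbar (fst (s n))"
      using eventually_compose_filterlim[OF eventually_subderivative_ge] by blast
    then have "\<forall>\<^sub>F n in sequentially. c \<le> ereal (snd (s n))"
      by (rule eventually_mono) (use s order_trans in blast)
    moreover have "(\<lambda>n. ereal (snd (s n))) \<longlonglongrightarrow> ereal y"
      using tendsto_snd[OF lim] by simp
    ultimately show "c \<le> ereal y"
      by (intro tendsto_lowerbound[of _ _ sequentially]) simp_all
  qed
  then show ?thesis
    unfolding closed_sequential_limits by (auto simp: case_prod_unfold)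
qed

text \<open>Replacing \<open>(t, u)\<close> by \<open>(t / l, l *\<^sub>R u)\<close> keeps the point
  \<open>xbar + t *\<^sub>R u\<close> and multiplies the difference quotient by
  \<open>l\<close>.\<close>

lemma subderivative_scaleR:
  assumes "0 < l"
  shows "subderivative f xbar (l *\<^sub>R h) = ereal l * subderivative f xbar h"
proof -
  let ?q = "\<lambda>(t, u). ereal ((f (xbar + t *\<^sub>R u) - f xbar) / t)"
  have right: "filterlim (\<lambda>p. c * fst p) (at_right 0) (at_right 0 \<times>\<^sub>F F)"
    if "0 < c" for c :: real and F :: "'a filter"
    using filterlim_compose[OF filterlim_times_pos[OF filterlim_ident that refl, of 0] filterlim_fst]
    by simp
  have vec: "filterlim (\<lambda>p. c *\<^sub>R snd p) (nhds (c *\<^sub>R v)) (F \<times>\<^sub>F nhds v)"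
    for c :: real and v :: 'a and F :: "real filter"
    by (intro tendsto_scaleR tendsto_const filterlim_snd)
  have to_lim: "filterlim (\<lambda>p. (inverse l * fst p, l *\<^sub>R snd p)) (at_right 0 \<times>\<^sub>F nhds (l *\<^sub>R h))
      (at_right 0 \<times>\<^sub>F nhds h)"
    by (intro filterlim_Pair right vec) (use assms in simp)
  have from_lim: "filterlim (\<lambda>p. (l * fst p, inverse l *\<^sub>R snd p)) (at_right 0 \<times>\<^sub>F nhds h)
      (at_right 0 \<times>\<^sub>F nhds (l *\<^sub>R h))"
    using assms vec[of "inverse l" "l *\<^sub>R h"] by (intro filterlim_Pair right) simp_all
  let ?m = "\<lambda>p :: real \<times> 'a. (inverse l * fst p, l *\<^sub>R snd p)"
  \<comment> \<open>The substitution has an inverse that is also compatible with the filters, so it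
    carries one filter exactly onto the other and the liminf is preserved, not just bounded on one
    side.\<close>
  have "?m (l * fst p, inverse l *\<^sub>R snd p) = p" for p
    using assms by (cases p) simp
  then have "filtermap ?m (at_right 0 \<times>\<^sub>F nhds h) = at_right 0 \<times>\<^sub>F nhds (l *\<^sub>R h)"
    by (intro filtermap_fun_inverse[OF from_lim to_lim] always_eventually allI)
  then have "subderivative f xbar (l *\<^sub>R h) = Liminf (filtermap ?m (at_right 0 \<times>\<^sub>F nhds h)) ?q"
    by (simp only: subderivative_def)
  also have "\<dots> = Liminf (at_right 0 \<times>\<^sub>F nhds h) (\<lambda>p. ?q (?m p))"
    by (rule Liminf_filtermap_eq) (use assms in \<open>auto simp: inj_on_def\<close>)
  also have "(\<lambda>p. ?q (?m p)) = (\<lambda>p. ereal l * ?q p)"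
    using assms by (auto simp: field_simps)
  also have "Liminf (at_right 0 \<times>\<^sub>F nhds h) \<dots> = ereal l * subderivative f xbar h"
    unfolding subderivative_def
    using assms by (intro Liminf_ereal_mult_left) (simp_all add: prod_filter_eq_bot)
  finally show ?thesis .
qed

text \<open>The translated graph point of \<open>x\<close> lies in the radial cone without any
  scaling.\<close>

lemma radial_epiderivative_le_increment:
  "radial_epiderivative f xbar (x - xbar) \<le> ereal (f x - f xbar)"
proof -
  have "(x, f x) - (xbar, f xbar) \<in> radial_cone (epigraph UNIV f) (xbar, f xbar)"
    unfolding radial_cone_def
    by (rule subsetD[OF closure_subset], rule hull_inc, rule imageI) (simp add: epigraph_def)
  then show ?thesis
    unfolding radial_epiderivative_def by (auto intro: Inf_lower)
qed

text \<open>A difference quotient below \<open>y\<close> at \<open>(t, u)\<close> puts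
  \<open>(u, y)\<close> into the cone generated by the translated epigraph. Such \<open>u\<close>
  occur arbitrarily close to \<open>h\<close>, so \<open>(h, y)\<close> lies in the closure.\<close>

lemma radial_epiderivative_le_subderivative:
  "radial_epiderivative f xbar h \<le> subderivative f xbar h"
proof (rule dense_ge)
  fix c assume "subderivative f xbar h < c"
  \<comment> \<open>The bound \<open>c\<close> may be infinite, whereas points of the cone need a
    real second coordinate.\<close>
  then obtain y where y: "subderivative f xbar h < ereal y" "ereal y < c"
    using ereal_dense2 by blast
  let ?K = "cone hull ((\<lambda>p. p - (xbar, f xbar)) ` epigraph UNIV f)"
  have "(h, y) \<in> closure ?K"
    unfolding closure_iff_nhds_not_empty
  proof (intro allI impI)
    fix V U assume "U \<subseteq> V" "open U" "(h, y) \<in> U"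
    then obtain A B where AB: "open A" "h \<in> A" "y \<in> B" "A \<times> B \<subseteq> V"
      by (metis open_prod_elim mem_Sigma_iff order_trans)
    \<comment> \<open>Otherwise the liminf would be at least \<open>y\<close>.\<close>
    have "\<not> (\<forall>\<^sub>F p in at_right 0 \<times>\<^sub>F nhds h.
        ereal y \<le> (case p of (t, u) \<Rightarrow> ereal ((f (xbar + t *\<^sub>R u) - f xbar) / t)))"
      using y(1) unfolding subderivative_def by (auto dest: Liminf_bounded simp: not_less)
    moreover have "\<forall>\<^sub>F t in at_right (0::real). 0 < t"
      by (rule eventually_at_right_less)
    moreover have "\<forall>\<^sub>F u in nhds h. u \<in> A"
      using AB by (simp add: eventually_nhds_in_open)
    ultimately obtain t u where tu: "0 < t" "u \<in> A" "(f (xbar + t *\<^sub>R u) - f xbar) / t < y"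
      unfolding eventually_prod_filter by (simp add: not_le) blast
    \<comment> \<open>The height is chosen so that scaling by \<open>inverse t\<close> gives exactly
      \<open>y\<close>; only the direction \<open>u\<close> has to approximate
      \<open>h\<close>.\<close>
    have "(xbar + t *\<^sub>R u, f xbar + t * y) \<in> epigraph UNIV f"
      using tu by (simp add: epigraph_def field_simps)
    moreover have "(u, y) = inverse t *\<^sub>R ((xbar + t *\<^sub>R u, f xbar + t * y) - (xbar, f xbar))"
      using tu by simp
    ultimately have "(u, y) \<in> ?K"
      unfolding cone_hull_expl using tu(1) by (smt (verit) image_eqI mem_Collect_eq inverse_nonnegative_iff_nonnegative)
    then show "?K \<inter> V \<noteq> {}" using tu AB by blast
  qed
  then have "radial_epiderivative f xbar h \<le> ereal y"
    unfolding radial_epiderivative_def radial_cone_def by (auto intro: Inf_lower)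
  with y(2) show "radial_epiderivative f xbar h \<le> c" by simp
qed

text \<open>The hypothesis covers translated epigraph points, homogeneity their positive multiples,
  and closedness the limits of these.\<close>

lemma subderivative_le_radial_epiderivative:
  assumes "\<And>x. subderivative f xbar (x - xbar) \<le> ereal (f x - f xbar)"
  shows "subderivative f xbar h \<le> radial_epiderivative f xbar h"
proof -
  let ?E = "{(h, y). subderivative f xbar h \<le> ereal y}"
  have base: "(xbar, f xbar) \<in> epigraph UNIV f" by (simp add: epigraph_def)
  have mem: "l *\<^sub>R (p - (xbar, f xbar)) \<in> ?E" if "0 < l" "p \<in> epigraph UNIV f" for l p
  proof -
    obtain x y where p: "p = (x, y)" "f x \<le> y"
      using \<open>p \<in> epigraph UNIV f\<close> by (cases p) (simp add: epigraph_def)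
    have "subderivative f xbar (x - xbar) \<le> ereal (y - f xbar)"
      by (rule order_trans[OF assms]) (use p(2) in simp)
    then have "ereal l * subderivative f xbar (x - xbar) \<le> ereal l * ereal (y - f xbar)"
      using \<open>0 < l\<close> by (intro ereal_mult_left_mono) simp_all
    then show ?thesis
      using p(1) by (simp add: subderivative_scaleR[OF \<open>0 < l\<close>])
  qed
  have "w \<in> ?E" if "w \<in> radial_cone (epigraph UNIV f) (xbar, f xbar)" for w
  proof -
    obtain l s where ls: "\<And>n. 0 < (l n :: real)" "\<And>n. s n \<in> epigraph UNIV f"
      "(\<lambda>n. l n *\<^sub>R (s n - (xbar, f xbar))) \<longlonglongrightarrow> w"
      using \<open>w \<in> _\<close> unfolding mem_radial_cone_iff[OF base] by blast
    show ?thesis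
      by (rule closed_sequentially[OF closed_subderivative_epigraph _ ls(3)]) (rule mem[OF ls(1,2)])
  qed
  then show ?thesis
    unfolding radial_epiderivative_def by (force intro: Inf_greatest)
qed

theorem corollary2:
  fixes f :: "'a::real_normed_vector \<Rightarrow> real" and xbar :: 'a
  assumes "proper_function (\<lambda>x. ereal (f x))"
    and "\<And>x. \<bar>subderivative f xbar (x - xbar)\<bar> \<noteq> \<infinity>"
  shows "(radially_epidifferentiable f xbar \<and>
          (\<forall>x. radial_epiderivative f xbar (x - xbar) = subderivative f xbar (x - xbar)))
     \<longleftrightarrow> (\<forall>x. ereal (f x - f xbar) \<ge> subderivative f xbar (x - xbar))"
proof
  assume "radially_epidifferentiable f xbar \<and>
    (\<forall>x. radial_epiderivative f xbar (x - xbar) = subderivative f xbar (x - xbar))"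
  then show "\<forall>x. ereal (f x - f xbar) \<ge> subderivative f xbar (x - xbar)"
    using radial_epiderivative_le_increment[of f xbar] by simp
next
  assume "\<forall>x. ereal (f x - f xbar) \<ge> subderivative f xbar (x - xbar)"
  then have eq: "radial_epiderivative f xbar h = subderivative f xbar h" for h
    by (intro antisym radial_epiderivative_le_subderivative subderivative_le_radial_epiderivative)
       simp
  \<comment> \<open>Every direction \<open>h\<close> has the form \<open>x - xbar\<close>, with
    \<open>x = xbar + h\<close>.\<close>
  have "\<bar>subderivative f xbar h\<bar> \<noteq> \<infinity>" for h
    using assms(2)[of "xbar + h"] by simp
  with eq show "radially_epidifferentiable f xbar \<and>
    (\<forall>x. radial_epiderivative f xbar (x - xbar) = subderivative f xbar (x - xbar))"
    by (simp add: radially_epidifferentiable_def)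
qed

end
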